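(* Let $\boldsymbol\lambda^*=(\lambda_1^*,\dots,\lambda_K^* )$, $\lambda_k^*\ge 0$, be an optimal dual vector of the continuous bandwidth-allocation problem described in the context. Then the retrieval utility function $$F:2^\Omega\to\mathbb R_{\ge 0},\qquad F(S)=\sum_{k=1}^K\lambda_k^*\big(\mathrm{Var}_k^{\mathrm{base}}-\mathrm{Var}[\hat y_k](S)\big)$$ is monotone non-decreasing (i.e. $F(A)\le F(Q)$ whenever $A\subseteq Q\subseteq\Omega$) and submodular (i.e. $F(A\cup\{z\})-F(A)\ge F(Q\cup\{z\})-F(Q)$ whenever $A\subseteq Q\subseteq\Omega$ and $z\in\Omega\setminus Q$).
   Context: $\Omega$ is a finite set of tiles; each tile $x\in\Omega$ has a channel $j(x)\in\{1,\dots,J\}$, duration $\delta t_x\in(0,\tau]$, bandwidth $\delta f_x>0$ and duty cycle $\alpha_x\in[0,1]$, where $\tau>0$ is the integration window. For $S\subseteq\Omega$ the effective clean bandwidth of channel $j$ is $$B_j(S)=B_j^{(0)}+\frac1\tau\sum_{x\in S,\ j(x)=j}\alpha_x\,\delta t_x\,\delta f_x,\qquad B_j^{(0)}>0.$$ For a bandwidth vector $B=(B_1,\dots,B_J)$ with $B_j>0$, real coefficients $c_{k,j}$, constants $\kappa_j>0$ and fixed residual interference penalties $\phi_j\ge0$ (the value $\phi_j(M_j)$ for the fixed interference mask $M_j$), the retrieval variance of product $k\in\{1,\dots,K\}$ is $$\mathrm{Var}[\hat y_k](B)=\sum_{j=1}^J c_{k,j}^2\Big(\frac{\kappa_j}{B_j\,\tau}+\phi_j\Big),$$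 and $\mathrm{Var}[\hat y_k](S)$ denotes its value at $B=(B_1(S),\dots,B_J(S))$. The baseline variance is $\mathrm{Var}_k^{\mathrm{base}}=\mathrm{Var}[\hat y_k](\emptyset)$, i.e. the variance when no tile is procured. Continuous problem: minimize $C_{\mathrm{tot}}(B)$ over continuously varying bandwidth vectors $B$ (with $B_j>0$) subject to $\mathrm{Var}[\hat y_k](B)\le\varepsilon_k^2$ for $k=1,\dots,K$, where $\varepsilon_k>0$ are given and $C_{\mathrm{tot}}$ is convex and non-decreasing in $B$. Its Lagrangian is $\mathcal L(B,\boldsymbol\lambda)=C_{\mathrm{tot}}(B)+\sum_{k=1}^K\lambda_k(\mathrm{Var}[\hat y_k](B)-\varepsilon_k^2)$ with multipliers $\lambda_k\ge0$; an optimal dual vector is a $\boldsymbol\lambda^*\in\mathbb R_{\ge0}^K$ maximizing the dual function $\boldsymbol\lambda\mapsto\inf_B\mathcal L(B,\boldsymbol\lambda)$ over $\mathbb R_{\ge 0}^K$. *)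

theory Defs
  imports "HOL-Analysis.Analysis"
begin

definition pos_bandwidths :: "(real ^ 'j::finite) set" where
  "pos_bandwidths = {B. \<forall>j. 0 < B $ j}"

definition eff_bandwidth ::
  "real \<Rightarrow> real ^ 'j::finite \<Rightarrow> ('x \<Rightarrow> 'j) \<Rightarrow> ('x \<Rightarrow> real) \<Rightarrow> ('x \<Rightarrow> real) \<Rightarrow> ('x \<Rightarrow> real)
    \<Rightarrow> 'x set \<Rightarrow> real ^ 'j" where
  "eff_bandwidth \<tau> B0 ch \<delta>t \<delta>f \<alpha> S =
    (\<chi> j. B0 $ j + 1 / \<tau> * (\<Sum>x\<in>{x\<in>S. ch x = j}. \<alpha> x * \<delta>t x * \<delta>f x))"

(* \<phi> j is the value of the residual interference penalty of channel j at its fixed mask. *)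
definition retrieval_var ::
  "real \<Rightarrow> ('k \<Rightarrow> 'j \<Rightarrow> real) \<Rightarrow> ('j \<Rightarrow> real) \<Rightarrow> ('j \<Rightarrow> real) \<Rightarrow> 'k \<Rightarrow> real ^ 'j::finite \<Rightarrow> real" where
  "retrieval_var \<tau> c \<kappa> \<phi> k B = (\<Sum>j\<in>UNIV. (c k j)\<^sup>2 * (\<kappa> j / (B $ j * \<tau>) + \<phi> j))"

definition lagrangian ::
  "real \<Rightarrow> ('k::finite \<Rightarrow> 'j \<Rightarrow> real) \<Rightarrow> ('j \<Rightarrow> real) \<Rightarrow> ('j \<Rightarrow> real) \<Rightarrow> (real ^ 'j::finite \<Rightarrow> real)
    \<Rightarrow> ('k \<Rightarrow> real) \<Rightarrow> real ^ 'j \<Rightarrow> real ^ 'k \<Rightarrow> real" where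
  "lagrangian \<tau> c \<kappa> \<phi> Ctot \<epsilon> B lam =
    Ctot B + (\<Sum>k\<in>UNIV. lam $ k * (retrieval_var \<tau> c \<kappa> \<phi> k B - (\<epsilon> k)\<^sup>2))"

(* Extended-real valued, so that the infimum is the true one without any boundedness side condition. *)
definition dual_function ::
  "real \<Rightarrow> ('k::finite \<Rightarrow> 'j \<Rightarrow> real) \<Rightarrow> ('j \<Rightarrow> real) \<Rightarrow> ('j \<Rightarrow> real) \<Rightarrow> (real ^ 'j::finite \<Rightarrow> real)
    \<Rightarrow> ('k \<Rightarrow> real) \<Rightarrow> real ^ 'k \<Rightarrow> ereal" where
  "dual_function \<tau> c \<kappa> \<phi> Ctot \<epsilon> lam =
    (INF B\<in>pos_bandwidths. ereal (lagrangian \<tau> c \<kappa> \<phi> Ctot \<epsilon> B lam))"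

definition optimal_dual ::
  "real \<Rightarrow> ('k::finite \<Rightarrow> 'j \<Rightarrow> real) \<Rightarrow> ('j \<Rightarrow> real) \<Rightarrow> ('j \<Rightarrow> real) \<Rightarrow> (real ^ 'j::finite \<Rightarrow> real)
    \<Rightarrow> ('k \<Rightarrow> real) \<Rightarrow> real ^ 'k \<Rightarrow> bool" where
  "optimal_dual \<tau> c \<kappa> \<phi> Ctot \<epsilon> lam \<longleftrightarrow>
    (\<forall>k. 0 \<le> lam $ k) \<and>
    (\<forall>mu. (\<forall>k. 0 \<le> mu $ k) \<longrightarrow>
      dual_function \<tau> c \<kappa> \<phi> Ctot \<epsilon> mu \<le> dual_function \<tau> c \<kappa> \<phi> Ctot \<epsilon> lam)"

definition retrieval_utility ::
  "real \<Rightarrow> real ^ 'j::finite \<Rightarrow> ('x \<Rightarrow> 'j) \<Rightarrow> ('x \<Rightarrow> real) \<Rightarrow> ('x \<Rightarrow> real) \<Rightarrow> ('x \<Rightarrow> real)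
    \<Rightarrow> ('k::finite \<Rightarrow> 'j \<Rightarrow> real) \<Rightarrow> ('j \<Rightarrow> real) \<Rightarrow> ('j \<Rightarrow> real) \<Rightarrow> real ^ 'k \<Rightarrow> 'x set \<Rightarrow> real" where
  "retrieval_utility \<tau> B0 ch \<delta>t \<delta>f \<alpha> c \<kappa> \<phi> lam S =
    (\<Sum>k\<in>UNIV. lam $ k *
      (retrieval_var \<tau> c \<kappa> \<phi> k (eff_bandwidth \<tau> B0 ch \<delta>t \<delta>f \<alpha> {})
       - retrieval_var \<tau> c \<kappa> \<phi> k (eff_bandwidth \<tau> B0 ch \<delta>t \<delta>f \<alpha> S)))"

definition submodular_on :: "'x set \<Rightarrow> ('x set \<Rightarrow> real) \<Rightarrow> bool" where
  "submodular_on \<Omega> F \<longleftrightarrow>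
    (\<forall>A Q z. A \<subseteq> Q \<and> Q \<subseteq> \<Omega> \<and> z \<in> \<Omega> - Q \<longrightarrow>
      F (A \<union> {z}) - F A \<ge> F (Q \<union> {z}) - F Q)"

end

(* The variance of each product is a nonnegative combination of the functions 1/B_j plus a constant,
   so it is antitone and convex separately in every channel.  Each B_j(S) is a modular,
   non-decreasing function of S, and a decreasing convex function of a modular non-decreasing
   function has diminishing decrements. *)
theory Submission
  imports Defs
begin

text \<open>Each decrement has the closed form d / (x * (x + d)), whose denominator grows with x >
  0. This is the convexity of 1/x in the discrete form that submodularity calls for.\<close>

lemma inverse_diff_antimono:
  fixes a b d :: real
  assumes "0 < a" "a \<le> b" "0 \<le> d"
  shows "1 / b - 1 / (b + d) \<le> 1 / a - 1 / (a + d)"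
proof -
  have "1 / b - 1 / (b + d) = d / (b * (b + d))"
    using assms by (simp add: field_simps)
  also have "\<dots> \<le> d / (a * (a + d))"
    using assms by (intro divide_left_mono mult_mono mult_pos_pos) auto
  also have "\<dots> = 1 / a - 1 / (a + d)"
    using assms by (simp add: field_simps)
  finally show ?thesis .
qed

text \<open>The penalties \<open>\<phi>\<close> cancel in a difference, leaving a weighted sum of
  differences of reciprocals. Monotonicity and diminishing decrements can then be checked channel by
  channel.\<close>

lemma retrieval_var_diff:
  "retrieval_var \<tau> c \<kappa> \<phi> k B - retrieval_var \<tau> c \<kappa> \<phi> k B' =
    (\<Sum>j\<in>UNIV. (c k j)\<^sup>2 * (\<kappa> j / \<tau>) * (1 / B $ j - 1 / B' $ j))"
  unfolding retrieval_var_def sum_subtractf [symmetric]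
  by (intro sum.cong refl) (simp add: algebra_simps diff_divide_distrib)

lemma retrieval_var_antimono:
  assumes "0 < \<tau>" "\<And>j. 0 < \<kappa> j" "\<And>j. 0 < B $ j" "B \<le> B'"
  shows "retrieval_var \<tau> c \<kappa> \<phi> k B' \<le> retrieval_var \<tau> c \<kappa> \<phi> k B"
proof -
  have "0 \<le> (c k j)\<^sup>2 * (\<kappa> j / \<tau>) * (1 / B $ j - 1 / B' $ j)" for j
  proof (intro mult_nonneg_nonneg)
    show "0 \<le> 1 / B $ j - 1 / B' $ j"
      using assms(3)[of j] assms(4) by (simp add: less_eq_vec_def frac_le)
  qed (use assms(1) assms(2)[of j] in auto)
  then have "0 \<le> retrieval_var \<tau> c \<kappa> \<phi> k B - retrieval_var \<tau> c \<kappa> \<phi> k B'"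
    unfolding retrieval_var_diff by (intro sum_nonneg) auto
  then show ?thesis by simp
qed

text \<open>Vector counterpart of submodularity: one common increment \<open>D\<close> is added to
  two componentwise comparable bandwidths. By \<open>retrieval_var_diff\<close> it reduces to
  \<open>inverse_diff_antimono\<close> in each channel, with non-negative weights.\<close>

lemma retrieval_var_diminishing:
  assumes "0 < \<tau>" "\<And>j. 0 < \<kappa> j" "\<And>j. 0 < B $ j" "B \<le> B'" "0 \<le> D"
  shows "retrieval_var \<tau> c \<kappa> \<phi> k B' - retrieval_var \<tau> c \<kappa> \<phi> k (B' + D)
    \<le> retrieval_var \<tau> c \<kappa> \<phi> k B - retrieval_var \<tau> c \<kappa> \<phi> k (B + D)"
  unfolding retrieval_var_diff
proof (intro sum_mono mult_left_mono)
  fix j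
  show "1 / B' $ j - 1 / (B' + D) $ j \<le> 1 / B $ j - 1 / (B + D) $ j"
    using assms(3)[of j] assms(4,5) by (simp add: less_eq_vec_def inverse_diff_antimono)
  show "0 \<le> (c k j)\<^sup>2 * (\<kappa> j / \<tau>)"
    using assms(1) assms(2)[of j] by simp
qed

lemma eff_bandwidth_mono:
  assumes "finite Q" "A \<subseteq> Q" "0 < \<tau>"
    and "\<And>x. x \<in> Q \<Longrightarrow> 0 \<le> \<alpha> x * \<delta>t x * \<delta>f x"
  shows "eff_bandwidth \<tau> B0 ch \<delta>t \<delta>f \<alpha> A \<le> eff_bandwidth \<tau> B0 ch \<delta>t \<delta>f \<alpha> Q"
proof -
  have "(\<Sum>x\<in>{x\<in>A. ch x = j}. \<alpha> x * \<delta>t x * \<delta>f x) \<le> (\<Sum>x\<in>{x\<in>Q. ch x = j}. \<alpha> x * \<delta>t x * \<delta>f x)" for j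
    using assms by (intro sum_mono2) auto
  then show ?thesis
    using assms(3) by (simp add: eff_bandwidth_def less_eq_vec_def divide_right_mono)
qed

lemma eff_bandwidth_empty [simp]: "eff_bandwidth \<tau> B0 ch \<delta>t \<delta>f \<alpha> {} = B0"
  by (simp add: eff_bandwidth_def vec_eq_iff)

lemma eff_bandwidth_pos:
  assumes "finite S" "0 < \<tau>" "\<And>j. 0 < B0 $ j"
    and "\<And>x. x \<in> S \<Longrightarrow> 0 \<le> \<alpha> x * \<delta>t x * \<delta>f x"
  shows "0 < eff_bandwidth \<tau> B0 ch \<delta>t \<delta>f \<alpha> S $ j"
  \<comment> \<open>Comparison with the empty set bounds the bandwidth from below by
    \<open>B0\<close>, which is positive.\<close>
  using eff_bandwidth_mono[of S "{}" \<tau> \<alpha> \<delta>t \<delta>f B0 ch] assms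
  by (auto simp: less_eq_vec_def intro: less_le_trans)

text \<open>Modularity: a new tile contributes a vector supported on its own channel and independent
  of \<open>S\<close>.\<close>

lemma eff_bandwidth_insert:
  assumes "finite S" "z \<notin> S"
  shows "eff_bandwidth \<tau> B0 ch \<delta>t \<delta>f \<alpha> (insert z S) =
    eff_bandwidth \<tau> B0 ch \<delta>t \<delta>f \<alpha> S + axis (ch z) (\<alpha> z * \<delta>t z * \<delta>f z / \<tau>)"
proof -
  have "{x \<in> insert z S. ch x = j} =
      (if ch z = j then insert z {x \<in> S. ch x = j} else {x \<in> S. ch x = j})" for j
    by auto
  then show ?thesis
    using assms by (auto simp: eff_bandwidth_def vec_eq_iff axis_def add_divide_distrib)
qed

theorem propositionV1:
  fixes \<Omega> :: "'x set" and ch :: "'x \<Rightarrow> 'j::finite"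
    and \<delta>t \<delta>f \<alpha> :: "'x \<Rightarrow> real" and \<tau> :: real
    and B0 :: "real ^ 'j" and \<kappa> \<phi> :: "'j \<Rightarrow> real"
    and c :: "'k::finite \<Rightarrow> 'j \<Rightarrow> real" and \<epsilon> :: "'k \<Rightarrow> real"
    and Ctot :: "real ^ 'j \<Rightarrow> real" and lam :: "real ^ 'k"
  assumes "finite \<Omega>" and "0 < \<tau>"
    and "\<And>x. x \<in> \<Omega> \<Longrightarrow> 0 < \<delta>t x \<and> \<delta>t x \<le> \<tau>"
    and "\<And>x. x \<in> \<Omega> \<Longrightarrow> 0 < \<delta>f x"
    and "\<And>x. x \<in> \<Omega> \<Longrightarrow> 0 \<le> \<alpha> x \<and> \<alpha> x \<le> 1"
    and "\<And>j. 0 < B0 $ j"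
    and "\<And>j. 0 < \<kappa> j" and "\<And>j. 0 \<le> \<phi> j"
    and "\<And>k. 0 < \<epsilon> k"
    and "convex_on pos_bandwidths Ctot"
    and "mono_on pos_bandwidths Ctot"
    and "optimal_dual \<tau> c \<kappa> \<phi> Ctot \<epsilon> lam"
  defines "F \<equiv> retrieval_utility \<tau> B0 ch \<delta>t \<delta>f \<alpha> c \<kappa> \<phi> lam"
  shows "(\<forall>S\<subseteq>\<Omega>. 0 \<le> F S) \<and> mono_on (Pow \<Omega>) F \<and> submodular_on \<Omega> F"
proof -
  let ?B = "eff_bandwidth \<tau> B0 ch \<delta>t \<delta>f \<alpha>"
  let ?V = "\<lambda>k S. retrieval_var \<tau> c \<kappa> \<phi> k (?B S)"
  \<comment> \<open>Dual feasibility makes \<open>F\<close> a non-negative combination of variance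
    reductions, so it suffices to treat each product separately.\<close>
  have lam: "0 \<le> lam $ k" for k
    using assms(12) by (simp add: optimal_dual_def)
  have weight: "0 \<le> \<alpha> x * \<delta>t x * \<delta>f x" if "x \<in> \<Omega>" for x
    using assms(3-5)[OF that] by simp
  have fin: "finite S" if "S \<subseteq> \<Omega>" for S
    using that assms(1) by (rule finite_subset)
  have pos: "0 < ?B S $ j" if "S \<subseteq> \<Omega>" for S j
    using that assms(2,6) weight by (intro eff_bandwidth_pos fin) auto
  have B_mono: "?B A \<le> ?B Q" if "A \<subseteq> Q" "Q \<subseteq> \<Omega>" for A Q
    using that assms(2) weight by (intro eff_bandwidth_mono fin) auto
  have mono: "F A \<le> F Q" if "A \<subseteq> Q" "Q \<subseteq> \<Omega>" for A Q
    unfolding F_def retrieval_utility_def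
  proof (intro sum_mono mult_left_mono lam diff_left_mono)
    show "?V k Q \<le> ?V k A" for k
      using that by (intro retrieval_var_antimono assms(2,7) pos B_mono) auto
  qed
  \<comment> \<open>The baseline is the variance at the empty set, so non-negativity of
    \<open>F\<close> is monotonicity starting from \<open>{}\<close>.\<close>
  have "F {} = 0"
    by (simp add: F_def retrieval_utility_def)
  with mono[of "{}"] have nonneg: "0 \<le> F S" if "S \<subseteq> \<Omega>" for S
    using that by auto
  \<comment> \<open>The baseline variance cancels, so marginal gains of \<open>F\<close> are
    weighted decrements of the variances.\<close>
  have F_diff: "F S' - F S = (\<Sum>k\<in>UNIV. lam $ k * (?V k S - ?V k S'))" for S S'
    unfolding F_def retrieval_utility_def sum_subtractf [symmetric]
    by (intro sum.cong refl) (simp add: algebra_simps diff_divide_distrib)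
  have "F (Q \<union> {z}) - F Q \<le> F (A \<union> {z}) - F A"
    if "A \<subseteq> Q" "Q \<subseteq> \<Omega>" "z \<in> \<Omega> - Q" for A Q z
    unfolding F_diff
  proof (intro sum_mono mult_left_mono lam)
    fix k
    \<comment> \<open>Since \<open>z\<close> lies outside \<open>Q\<close>, hence outside
      \<open>A\<close>, adding it shifts both bandwidths by this same vector.\<close>
    let ?D = "axis (ch z) (\<alpha> z * \<delta>t z * \<delta>f z / \<tau>) :: real ^ 'j"
    have "0 \<le> ?D"
      using weight[of z] that assms(2) by (simp add: less_eq_vec_def axis_def)
    moreover have "?B (A \<union> {z}) = ?B A + ?D" "?B (Q \<union> {z}) = ?B Q + ?D"
      using that fin[of A] fin[of Q] by (auto intro!: eff_bandwidth_insert)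
    ultimately show "?V k Q - ?V k (Q \<union> {z}) \<le> ?V k A - ?V k (A \<union> {z})"
      using retrieval_var_diminishing[of \<tau> \<kappa> "?B A" "?B Q" ?D] pos[of A] B_mono[of A Q]
        assms(2,7) that by auto
  qed
  with mono nonneg show ?thesis
    by (auto simp: submodular_on_def mono_on_def)
qed

end
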